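(* Let $q$ be a prime power. The sign preservers on $M_2(\mathbb{F}_q)$ are precisely: (1) the bijective monomials, i.e., the functions $f(x)=cx^n$ with $c\in\mathbb{F}_q^*$, $1\le n\le q-1$ and $\gcd(n,q-1)=1$, when $q$ is even; (2) the positive multiples of the field automorphisms of $\mathbb{F}_q$, i.e., the functions $f=c\,\sigma$ with $c\in\mathbb{F}_q^+$ and $\sigma$ a field automorphism of $\mathbb{F}_q$, when $q$ is odd.
   Context: $\mathbb{F}_q$ is the finite field with $q$ elements, $\mathbb{F}_q^*=\mathbb{F}_q\setminus\{0\}$, and $\mathbb{F}_q^+:=\{x^2:x\in\mathbb{F}_q^*\}$. $M_n(\mathbb{F}_q)$ is the set of $n\times n$ matrices over $\mathbb{F}_q$. A matrix $A\in M_n(\mathbb{F}_q)$ is positive definite if $A$ is symmetric and all its leading principal minors are non-zero squares in $\mathbb{F}_q$. For $A=(a_{ij})$ and $f:\mathbb{F}_q\to\mathbb{F}_q$, write $f[A]:=(f(a_{ij}))$. A function $f:\mathbb{F}_q\to\mathbb{F}_q$ is a sign preserver on $M_n(\mathbb{F}_q)$ if for every symmetric $A\in M_n(\mathbb{F}_q)$, $A$ is positive definite if and only if $f[A]$ is positive definite. *)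

theory Defs
  imports "HOL-Library.Cardinality" "Jordan_Normal_Form.Determinant" "Jordan_Normal_Form.DL_Submatrix"
begin

definition positive_elements :: "'a::field set" where
  "positive_elements = {x\<^sup>2 | x. x \<noteq> 0}"

definition leading_principal_minor :: "'a::comm_ring_1 mat \<Rightarrow> nat \<Rightarrow> 'a" where
  "leading_principal_minor A k = det (submatrix A {..<k} {..<k})"

definition symmetric_matrix :: "nat \<Rightarrow> 'a mat \<Rightarrow> bool" where
  "symmetric_matrix n A \<longleftrightarrow> A \<in> carrier_mat n n \<and> transpose_mat A = A"

definition positive_definite_matrix :: "nat \<Rightarrow> 'a::field mat \<Rightarrow> bool" where
  "positive_definite_matrix n A \<longleftrightarrow>
     symmetric_matrix n A \<and> (\<forall>k\<in>{1..n}. leading_principal_minor A k \<in> positive_elements)"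

definition sign_preserver :: "nat \<Rightarrow> ('a::field \<Rightarrow> 'a) \<Rightarrow> bool" where
  "sign_preserver n f \<longleftrightarrow>
     (\<forall>A. symmetric_matrix n A \<longrightarrow>
        (positive_definite_matrix n A \<longleftrightarrow> positive_definite_matrix n (map_mat f A)))"

definition bijective_monomials :: "('a::{field,finite} \<Rightarrow> 'a) set" where
  "bijective_monomials =
     {(\<lambda>x. c * x ^ n) | c n.
        c \<noteq> 0 \<and> 1 \<le> n \<and> n \<le> CARD('a) - 1 \<and> gcd n (CARD('a) - 1) = 1}"

(* field_isom, instantiated from a field to itself, is the locale of surjective field
   homomorphisms; injectivity is automatic. *)
definition positive_multiples_of_automorphisms :: "('a::field \<Rightarrow> 'a) set" where
  "positive_multiples_of_automorphisms =
     {(\<lambda>x. c * \<sigma> x) | c \<sigma>. c \<in> positive_elements \<and> field_isom \<sigma>}"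

end

theory Submission
  imports
    Defs
    "HOL-Algebra.Sylow"
    "HOL-Number_Theory.Residues"
begin

text \<open>
  A symmetric matrix with diagonal \<open>a, c\<close> and off-diagonal entry \<open>b\<close> is positive definite iff \<open>a\<close>
  and \<open>a * c - b\<^sup>2\<close> lie in the set \<open>P\<close> of nonzero squares.

  If \<open>q\<close> is even, every element is a square, and a sign preserver \<open>f\<close> has to preserve and
  reflect the equation \<open>a * c = b\<^sup>2\<close>.  So \<open>f\<close> is a multiple of a multiplicative bijection, which is a
  power map because the multiplicative group is cyclic (\<open>multiplicative_injection_is_power\<close>).

  If \<open>q\<close> is odd, normalise \<open>f\<close> to \<open>f 1 = 1\<close>.  For \<open>a\<close> in \<open>P\<close>, the condition says that \<open>f\<close> takes the
  translate \<open>P + b\<^sup>2 / a\<close> to \<open>P + (f b)\<^sup>2 / f a\<close>.  Two rigidity facts turn this into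
  multiplicativity and injectivity of \<open>f\<close> (\<open>normalized_sign_preserver_multiplicative\<close>): a translate of
  \<open>P\<close> determines the translation vector (\<open>positive_elements_translate_eqD\<close>), and a nonsquare \<open>c\<close> is
  determined by the set of squares \<open>y\<^sup>2\<close> for which \<open>c - y\<^sup>2\<close> is in \<open>P\<close>
  (\<open>nonsquare_determined_by_square_differences\<close>).  So \<open>f x = x ^ k\<close>, and \<open>f x - 1\<close> is in \<open>P\<close> iff \<open>x - 1\<close>
  is.  That such a power map is a field automorphism is a case of a theorem of Carlitz.  Here
  the proof compares the coefficients in \<open>(x ^ k - 1) ^ m = (x - 1) ^ m\<close> for \<open>m = (q - 1) div 2\<close>:
  multiplication by \<open>k\<close> modulo \<open>q - 1\<close> has to keep the exponents with nonzero binomial coefficient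
  in the lower half \<open>{0..m}\<close>, and by Lucas' theorem there are so many such exponents that
  \<open>k * p ^ t\<close> is congruent to 1 modulo \<open>q - 1\<close> for some \<open>t\<close>
  (\<open>exponent_inverse_of_prime_power\<close>).  So \<open>f\<close> inverts a power of the Frobenius automorphism.

  Conversely, the maps in question commute with the determinant condition: a power map is
  multiplicative and injective, and an automorphism commutes with \<open>a * c - b\<^sup>2\<close> and preserves and
  reflects \<open>P\<close>.
\<close>

section \<open>Finite fields\<close>

lemma card_field_gt_1: "CARD('a::{field,finite}) > 1"
proof -
  have "card {0::'a, 1} \<le> CARD('a)" by (rule card_mono) auto
  thus ?thesis by simp
qed

text \<open>
  The multiplicative group of a finite field is cyclic of order \<open>q - 1\<close>.  The element \<open>u\<close> turns
  questions about powers and squares into congruences between exponents.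
\<close>

lemma primitive_element_exists:
  "\<exists>u::'a::{field,finite}. u \<noteq> 0 \<and> (\<forall>x. x \<noteq> 0 \<longrightarrow> (\<exists>i. x = u ^ i)) \<and>
     (\<forall>i j. u ^ i = u ^ j \<longleftrightarrow> [i = j] (mod CARD('a) - 1))"
proof -
  define R :: "'a ring" where "R = \<lparr>carrier = (UNIV :: 'a set), mult = (*), one = 1, zero = 0, add = (+)\<rparr>"
  interpret R: field R
  proof unfold_locales
    have "\<exists>y. y * x = 1 \<and> x * y = 1" if "x \<noteq> 0" for x :: 'a
      using that by (intro exI[of _ "inverse x"]) simp
    thus "Units R = carrier R - {\<zero>\<^bsub>R\<^esub>}"
      by (auto simp: Units_def R_def)
    have "\<exists>y. y + x = 0 \<and> x + y = 0" for x :: 'a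
      by (intro exI[of _ "- x"]) simp
    thus "carrier (add_monoid R) \<subseteq> Units (add_monoid R)"
      by (auto simp: Units_def R_def)
  qed (auto simp: R_def algebra_simps)
  have pow: "x [^]\<^bsub>R\<^esub> i = x ^ i" for x :: 'a and i :: nat
    by (induction i) (auto simp: R_def nat_pow_def mult.commute)
  have pow': "x [^]\<^bsub>mult_of R\<^esub> i = x ^ i" for x :: 'a and i :: nat
    using pow by (simp add: nat_pow_mult_of)
  have carr: "carrier (mult_of R) = UNIV - {0}"
    by (auto simp: R_def)
  have finR: "finite (carrier R)" by (simp add: R_def)
  obtain u where u: "u \<in> carrier (mult_of R)"
    and gen: "carrier (mult_of R) = {u [^]\<^bsub>R\<^esub> i | i::nat. i \<in> UNIV}"
    using R.finite_field_mult_group_has_gen finR by blast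
  interpret M: group "mult_of R" by (rule R.field_mult_group)
  define N where "N = CARD('a) - 1"
  have "CARD('a) > 1" by (rule card_field_gt_1)
  hence N: "N > 0" by (simp add: N_def)
  have cardN: "card (UNIV - {0::'a}) = N" by (simp add: N_def)
  have u0: "u \<noteq> 0" using u carr by auto
  have "u [^]\<^bsub>mult_of R\<^esub> order (mult_of R) = \<one>\<^bsub>mult_of R\<^esub>"
    by (rule M.pow_order_eq_1[OF u])
  hence uN: "u ^ N = 1" by (simp add: pow' order_def carr cardN) (simp add: R_def N_def)
  have mod: "u ^ i = u ^ (i mod N)" for i
  proof -
    have "u ^ i = u ^ (N * (i div N) + i mod N)" by simp
    thus ?thesis unfolding power_add power_mult uN by simp
  qed
  have "(\<lambda>i. u ^ i) ` {..<N} = UNIV - {0}"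
  proof (intro subset_antisym subsetI)
    fix x :: 'a assume "x \<in> UNIV - {0}"
    hence "x \<in> {u [^]\<^bsub>R\<^esub> i | i::nat. i \<in> UNIV}" using gen carr by blast
    then obtain i :: nat where "x = u ^ i" using pow by auto
    thus "x \<in> (\<lambda>i. u ^ i) ` {..<N}" using mod[of i] N by (intro image_eqI[of _ _ "i mod N"]) simp_all
  qed (use u0 in auto)
  moreover from this have inj: "inj_on (\<lambda>i. u ^ i) {..<N}"
    using cardN by (intro eq_card_imp_inj_on) auto
  ultimately show ?thesis
  proof (intro exI[of _ u] conjI allI)
    show "u ^ i = u ^ j \<longleftrightarrow> [i = j] (mod CARD('a) - 1)" for i j
      using inj_on_eq_iff[OF inj, of "i mod N" "j mod N"] N mod[of i] mod[of j]
      unfolding N_def[symmetric] cong_def by simp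
  qed (use u0 in auto)
qed

lemma finite_field_nonzero_power_eq_1:
  fixes x :: "'a::{field,finite}"
  assumes "x \<noteq> 0"
  shows "x ^ (CARD('a) - 1) = 1"
proof -
  obtain u :: 'a where u: "\<And>x. x \<noteq> 0 \<Longrightarrow> \<exists>i. x = u ^ i"
    "\<And>i j. u ^ i = u ^ j \<longleftrightarrow> [i = j] (mod CARD('a) - 1)"
    using primitive_element_exists by blast
  obtain i where "x = u ^ i" using u(1) assms by auto
  hence "x ^ (CARD('a) - 1) = u ^ (i * (CARD('a) - 1))" by (simp add: power_mult)
  also have "\<dots> = u ^ 0" unfolding u(2) by (simp add: cong_def)
  finally show ?thesis by simp
qed

text \<open>
  An endomorphism of a cyclic group is determined by the image \<open>u ^ k\<close> of a generator \<open>u\<close>, and it is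
  injective only if \<open>k\<close> is coprime to the order of the group.
\<close>

lemma multiplicative_injection_is_power:
  fixes g :: "'a::{field,finite} \<Rightarrow> 'a"
  assumes mult: "\<And>x y. g (x * y) = g x * g y" and inj: "inj g"
  obtains k where "1 \<le> k" "k \<le> CARD('a) - 1" "coprime k (CARD('a) - 1)" "\<And>x. g x = x ^ k"
proof -
  define N where "N = CARD('a) - 1"
  have "CARD('a) > 1" by (rule card_field_gt_1)
  hence N: "N > 0" by (simp add: N_def)
  obtain u :: 'a where u0: "u \<noteq> 0" and u: "\<And>x. x \<noteq> 0 \<Longrightarrow> \<exists>i. x = u ^ i"
    "\<And>i j. u ^ i = u ^ j \<longleftrightarrow> [i = j] (mod N)"
    unfolding N_def using primitive_element_exists by blast
  have g0: "g 0 = 0"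
    using mult[of 0 0] mult[of 0 1] injD[OF inj, of 0 1] by auto
  have nz: "g x \<noteq> 0" if "x \<noteq> 0" for x
    using injD[OF inj, of x 0] g0 that by auto
  have g1: "g 1 = 1" using mult[of 1 1] nz[of 1] by auto
  obtain j where j: "g u = u ^ j" using u nz[OF u0] by blast
  \<comment> \<open>The exponent only matters modulo \<open>N\<close>; the representative \<open>N\<close> instead of \<open>0\<close> makes
    the formula \<open>g x = x ^ k\<close> correct at \<open>x = 0\<close>, too.\<close>
  define k where "k = (if j mod N = 0 then N else j mod N)"
  have k: "1 \<le> k" "k \<le> N" using N by (auto simp: k_def Suc_le_eq less_imp_le)
  have "[j = k] (mod N)" by (auto simp: k_def cong_def)
  hence gu: "g u = u ^ k" using j u(2) by simp
  have gpow: "g (u ^ i) = u ^ (k * i)" for i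
    by (induction i) (auto simp: g1 mult gu power_add)
  have gx: "g x = x ^ k" for x
  proof (cases "x = 0")
    case False
    then obtain i where "x = u ^ i" using u by blast
    thus ?thesis using gpow by (simp add: mult.commute flip: power_mult)
  qed (use g0 k in auto)
  have "coprime k N"
  proof -
    \<comment> \<open>With \<open>d = gcd k N\<close>, the element \<open>u ^ (N div d)\<close> is mapped to 1, so it is 1 by injectivity,
      which forces \<open>d = 1\<close>.\<close>
    define d where "d = gcd k N"
    define i where "i = N div d"
    have d: "d * i = N" by (simp add: d_def i_def)
    have "k * i = (k div d) * N"
      using d by (metis d_def dvd_div_mult_self gcd_dvd1 mult.assoc mult.commute)
    hence "[k * i = k * 0] (mod N)" by (simp add: cong_def)
    hence "g (u ^ i) = g (u ^ 0)" unfolding gpow u(2) .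
    hence "[i = 0] (mod N)" using injD[OF inj] u(2) by blast
    hence "N dvd i" by (simp add: cong_0_iff)
    moreover have "i > 0" using d N by (cases i) auto
    ultimately have "d * i \<le> i" using d dvd_imp_le by auto
    hence "d \<le> 1" using \<open>i > 0\<close> by auto
    moreover have "d \<noteq> 0" using d N by (cases d) auto
    ultimately have "d = 1" by simp
    thus ?thesis unfolding d_def coprime_iff_gcd_eq_1 .
  qed
  thus thesis using that k gx N_def by auto
qed

lemma inj_power_of_coprime:
  assumes "coprime n (CARD('a::{field,finite}) - 1)" "n \<ge> 1"
  shows "inj (\<lambda>x::'a. x ^ n)"
proof (rule injI)
  fix x y :: 'a assume eq: "x ^ n = y ^ n"
  obtain u :: 'a where u: "\<And>x. x \<noteq> 0 \<Longrightarrow> \<exists>i. x = u ^ i"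
    "\<And>i j. u ^ i = u ^ j \<longleftrightarrow> [i = j] (mod CARD('a) - 1)"
    using primitive_element_exists by blast
  show "x = y"
  proof (cases "x = 0 \<or> y = 0")
    case True thus ?thesis using eq assms(2) by (auto simp: power_0_left split: if_splits)
  next
    case False
    then obtain i j where ij: "x = u ^ i" "y = u ^ j" using u by blast
    with eq have "u ^ (i * n) = u ^ (j * n)" by (simp add: power_mult)
    thus ?thesis unfolding ij u(2) using assms(1) cong_mult_rcancel_nat by blast
  qed
qed

text \<open>
  By Cauchy's theorem for the additive group, each prime divisor \<open>l\<close> of the number of elements kills a
  nonzero element, so \<open>l = 0\<close> in the field and \<open>l\<close> is the characteristic.
\<close>

lemma card_finite_field_prime_power:
  obtains n where "n \<ge> 1" "prime CHAR('a)" "CARD('a::{field,finite}) = CHAR('a) ^ n"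
proof -
  have p: "prime CHAR('a)"
    using prime_CHAR_semidom finite_imp_CHAR_pos[where 'a='a] by auto
  define q where "q = CARD('a)"
  have "CARD('a) > 1" by (rule card_field_gt_1)
  hence q: "q > 1" by (simp add: q_def)
  define G where "G = \<lparr>carrier = (UNIV :: 'a set), monoid.mult = (+), one = (0 :: 'a)\<rparr>"
  interpret G: group G
  proof (rule groupI)
    fix x assume x: "x \<in> carrier G"
    show "\<exists>y\<in>carrier G. y \<otimes>\<^bsub>G\<^esub> x = \<one>\<^bsub>G\<^esub>"
      by (intro bexI[of _ "-x"]) (auto simp: G_def)
  qed (auto simp: G_def add_ac)
  have powG: "x [^]\<^bsub>G\<^esub> i = of_nat i * x" for x :: 'a and i :: nat
    by (induction i) (auto simp: G_def algebra_simps)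
  have "l = CHAR('a)" if l: "prime l" "l dvd q" for l
  proof -
    obtain m where m: "q = l ^ 1 * m" using l(2) by auto
    obtain H where H: "subgroup H G" "card H = l ^ 1"
      using sylow_thm[OF l(1) G.group_axioms, of 1 m] m by (auto simp: order_def G_def q_def)
    have "\<not> H \<subseteq> {0}" using card_mono[of "{0::'a}" H] H(2) prime_gt_1_nat[OF l(1)] by auto
    then obtain x where x: "x \<in> H" "x \<noteq> 0" by auto
    interpret H: group "G\<lparr>carrier := H\<rparr>" using H(1) by (rule G.subgroup_imp_group)
    have "x [^]\<^bsub>G\<lparr>carrier := H\<rparr>\<^esub> order (G\<lparr>carrier := H\<rparr>) = \<one>\<^bsub>G\<lparr>carrier := H\<rparr>\<^esub>"
      by (rule H.pow_order_eq_1) (use x in auto)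
    hence "x [^]\<^bsub>G\<^esub> l = \<one>\<^bsub>G\<^esub>"
      using H(2) by (simp add: order_def nat_pow_def)
    hence "of_nat l * x = 0" unfolding powG by (simp add: G_def)
    hence "CHAR('a) dvd l" using x(2) by (simp add: of_nat_eq_0_iff_char_dvd)
    thus ?thesis using l(1) p primes_dvd_imp_eq by blast
  qed
  hence "prime_factors q \<subseteq> {CHAR('a)}" by (auto simp: prime_factors_dvd)
  hence "q = CHAR('a) ^ multiplicity CHAR('a) q"
    using prime_factorization_nat[of q] q
    by (cases "CHAR('a) \<in> prime_factors q") (auto simp: subset_singleton_iff)
  moreover have "multiplicity CHAR('a) q \<ge> 1"
    using calculation q by (cases "multiplicity CHAR('a) q") auto
  ultimately show thesis using that p q_def by blast
qed

section \<open>Squares in finite fields of odd order\<close>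

lemma of_nat_card_eq_0: "of_nat CARD('a) = (0 :: 'a::{field,finite})"
  using CHAR_dvd_CARD[where 'a='a] by (simp only: of_nat_eq_0_iff_char_dvd)

lemma one_in_positive_elements: "1 \<in> (positive_elements :: 'a::field set)"
  unfolding positive_elements_def by (auto intro!: exI[of _ 1])

lemma zero_notin_positive_elements: "0 \<notin> (positive_elements :: 'a::field set)"
  unfolding positive_elements_def by auto

lemma power2_in_positive_elements: "x \<noteq> 0 \<Longrightarrow> x\<^sup>2 \<in> (positive_elements :: 'a::field set)"
  unfolding positive_elements_def by auto

lemma power_in_positive_elements_iff:
  fixes u :: "'a::{field,finite}"
  assumes "odd CARD('a)" "u \<noteq> 0" "\<And>x. x \<noteq> 0 \<Longrightarrow> \<exists>i. x = u ^ i"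
    "\<And>i j. u ^ i = u ^ j \<longleftrightarrow> [i = j] (mod CARD('a) - 1)"
  shows "u ^ i \<in> positive_elements \<longleftrightarrow> even i"
proof
  assume "even i"
  then obtain j where "i = j * 2" by (metis evenE mult.commute)
  hence "u ^ i = (u ^ j)\<^sup>2" by (simp add: power_mult)
  thus "u ^ i \<in> positive_elements" using assms(2) by (simp add: power2_in_positive_elements)
next
  assume "u ^ i \<in> positive_elements"
  then obtain x where x: "x \<noteq> 0" "u ^ i = x\<^sup>2" by (auto simp: positive_elements_def)
  then obtain j where "x = u ^ j" using assms(3) by blast
  hence "u ^ i = u ^ (j * 2)" using x(2) by (simp add: power_mult)
  hence "[i = j * 2] (mod CARD('a) - 1)" using assms(4) by simp
  moreover have "2 dvd CARD('a) - 1" using assms(1) by simp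
  ultimately have "[i = j * 2] (mod 2)" by (rule cong_dvd_modulus_nat)
  thus "even i" using cong_dvd_iff by fastforce
qed

lemma times_in_positive_elements_iff:
  fixes x y :: "'a::{field,finite}"
  assumes "odd CARD('a)" "x \<noteq> 0" "y \<noteq> 0"
  shows "x * y \<in> positive_elements \<longleftrightarrow> (x \<in> positive_elements \<longleftrightarrow> y \<in> positive_elements)"
proof -
  obtain u :: 'a where u: "u \<noteq> 0" "\<And>x. x \<noteq> 0 \<Longrightarrow> \<exists>i. x = u ^ i"
    "\<And>i j. u ^ i = u ^ j \<longleftrightarrow> [i = j] (mod CARD('a) - 1)"
    using primitive_element_exists by blast
  note sq = power_in_positive_elements_iff[OF assms(1) u]
  obtain i j where ij: "x = u ^ i" "y = u ^ j" using u(2) assms by blast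
  have "x * y = u ^ (i + j)" by (simp add: ij power_add)
  thus ?thesis using sq[of i] sq[of j] sq[of "i + j"] ij by auto
qed

lemma divide_in_positive_elements_iff:
  fixes x y :: "'a::{field,finite}"
  assumes "odd CARD('a)" "x \<noteq> 0" "y \<noteq> 0"
  shows "x / y \<in> positive_elements \<longleftrightarrow> (x \<in> positive_elements \<longleftrightarrow> y \<in> positive_elements)"
  using times_in_positive_elements_iff[OF assms(1), of "x / y" y] assms by auto

lemma euler_criterion:
  fixes x :: "'a::{field,finite}"
  assumes "odd CARD('a)" "x \<noteq> 0"
  shows "x ^ ((CARD('a) - 1) div 2) = (if x \<in> positive_elements then 1 else - 1)"
proof -
  define m where "m = (CARD('a) - 1) div 2"
  have m: "CARD('a) - 1 = 2 * m" using assms(1) by (simp add: m_def)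
  have "CARD('a) > 1" by (rule card_field_gt_1)
  hence m1: "m \<ge> 1" using m by (cases m) auto
  obtain u :: 'a where u: "u \<noteq> 0" "\<And>x. x \<noteq> 0 \<Longrightarrow> \<exists>i. x = u ^ i"
    "\<And>i j. u ^ i = u ^ j \<longleftrightarrow> [i = j] (mod CARD('a) - 1)"
    using primitive_element_exists by blast
  note sq = power_in_positive_elements_iff[OF assms(1) u]
  obtain i where i: "x = u ^ i" using u assms by blast
  have "(x ^ m - 1) * (x ^ m + 1) = x ^ (CARD('a) - 1) - 1"
    unfolding m by (simp add: algebra_simps flip: power_add mult_2)
  also have "\<dots> = 0" using finite_field_nonzero_power_eq_1[OF assms(2)] by simp
  finally have "x ^ m = 1 \<or> x ^ m = - 1" by (simp add: eq_neg_iff_add_eq_0)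
  moreover have "x ^ m = 1 \<longleftrightarrow> x \<in> positive_elements"
  proof -
    have "x ^ m = 1 \<longleftrightarrow> u ^ (m * i) = u ^ 0" by (simp add: i mult.commute flip: power_mult)
    also have "\<dots> \<longleftrightarrow> m * 2 dvd m * i" unfolding u(3) m by (simp add: cong_0_iff mult.commute)
    also have "\<dots> \<longleftrightarrow> even i" using m1 by (simp add: nat_mult_dvd_cancel_disj)
    finally show ?thesis using sq i by simp
  qed
  ultimately show ?thesis by (auto simp: m_def)
qed

lemma card_positive_elements:
  assumes "odd CARD('a::{field,finite})"
  shows "2 * card (positive_elements :: 'a set) + 1 = CARD('a)"
proof -
  obtain u :: 'a where u: "u \<noteq> 0" "\<And>x. x \<noteq> 0 \<Longrightarrow> \<exists>i. x = u ^ i"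
    "\<And>i j. u ^ i = u ^ j \<longleftrightarrow> [i = j] (mod CARD('a) - 1)"
    using primitive_element_exists by blast
  note sq = power_in_positive_elements_iff[OF assms(1) u]
  define N where "N = {x :: 'a. x \<noteq> 0 \<and> x \<notin> positive_elements}"
  have N: "(\<lambda>x. u * x) ` positive_elements = N"
  proof (intro subset_antisym subsetI)
    fix x assume "x \<in> N"
    hence "x / u \<in> positive_elements"
      using divide_in_positive_elements_iff[OF assms, of x u] u(1) sq[of 1] by (simp add: N_def)
    thus "x \<in> (\<lambda>x. u * x) ` positive_elements" using u(1) by (intro image_eqI[of _ _ "x / u"]) auto
  next
    fix x assume "x \<in> (\<lambda>x. u * x) ` positive_elements"
    then obtain y where y: "y \<in> positive_elements" "x = u * y" by auto
    hence "y \<noteq> 0" using zero_notin_positive_elements by auto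
    thus "x \<in> N" using times_in_positive_elements_iff[OF assms, of u y] u(1) sq[of 1] y by (simp add: N_def)
  qed
  have "inj_on (\<lambda>x. u * x) positive_elements" using u(1) by (auto simp: inj_on_def)
  hence c: "card N = card (positive_elements :: 'a set)" using card_image N by blast
  have "(UNIV :: 'a set) = insert 0 (positive_elements \<union> N)" by (auto simp: N_def)
  hence "CARD('a) = card (insert 0 (positive_elements \<union> N))" by (rule arg_cong)
  also have "\<dots> = Suc (card (positive_elements \<union> N))"
    by (subst card_insert_disjoint) (auto simp: N_def zero_notin_positive_elements)
  also have "card (positive_elements \<union> N) = card (positive_elements :: 'a set) + card N"
    by (rule card_Un_disjoint) (auto simp: N_def)
  finally show ?thesis using c by simp
qed

text \<open>
  If \<open>P\<close> is the set of nonzero squares and \<open>P + u = P + v\<close>, then summing all elements of both sets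
  gives \<open>of_nat (card P) * (u - v) = 0\<close>; and \<open>of_nat (card P)\<close> is nonzero since
  \<open>2 * of_nat (card P) + 1 = of_nat q = 0\<close>.
\<close>

lemma positive_elements_translate_eqD:
  fixes u v :: "'a::{field,finite}"
  assumes odd: "odd CARD('a)"
    and eq: "\<And>x. x - u \<in> positive_elements \<longleftrightarrow> x - v \<in> positive_elements"
  shows "u = v"
proof -
  define P where "P = (positive_elements :: 'a set)"
  define d where "d = u - v"
  have "(\<Sum>x\<in>P. x + d) = (\<Sum>x\<in>P. x)"
  proof (rule sum.reindex_bij_witness[of _ "\<lambda>x. x - d" "\<lambda>x. x + d"])
    show "x + d \<in> P" if "x \<in> P" for x
      using eq[of "x + u"] that by (simp add: P_def d_def algebra_simps)
    show "x - d \<in> P" if "x \<in> P" for x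
      using eq[of "x + v"] that by (simp add: P_def d_def algebra_simps)
  qed auto
  hence "of_nat (card P) * d = 0" by (simp add: sum.distrib)
  moreover have "of_nat (card P) \<noteq> (0 :: 'a)"
  proof
    assume "of_nat (card P) = (0 :: 'a)"
    hence "of_nat (2 * card P + 1) = (1 :: 'a)" by simp
    thus False unfolding P_def card_positive_elements[OF odd] of_nat_card_eq_0 by simp
  qed
  ultimately show ?thesis by (simp add: d_def)
qed

text \<open>
  For \<open>c \<noteq> c'\<close>, the Moebius transformation \<open>y \<mapsto> (c - y) / (c' - y)\<close> is injective; let \<open>g\<close> be its
  inverse.  If \<open>w\<close> is a nonsquare, then exactly one of \<open>c - g w\<close> and \<open>c' - g w\<close> is a nonzero square,
  so \<open>g w\<close> is not a square by the assumption, and it is not \<open>c\<close> either.  Thus \<open>g\<close> injects the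
  nonsquares into the nonsquares other than \<open>c\<close>.

  The assumption on \<open>c\<close> cannot be dropped: in the field with 5 elements, \<open>1 - y\<^sup>2\<close> and \<open>4 - y\<^sup>2\<close> are
  nonzero squares for the same \<open>y\<close>, namely for \<open>y = 0\<close> only.
\<close>

lemma nonsquare_determined_by_square_differences:
  fixes c c' :: "'a::{field,finite}"
  assumes odd: "odd CARD('a)" and c: "c \<noteq> 0" "c \<notin> positive_elements"
    and eq: "\<And>y. c - y\<^sup>2 \<in> positive_elements \<longleftrightarrow> c' - y\<^sup>2 \<in> positive_elements"
  shows "c = c'"
proof (rule ccontr)
  assume neq: "c \<noteq> c'"
  define N where "N = {x :: 'a. x \<noteq> 0 \<and> x \<notin> positive_elements}"
  define g where "g = (\<lambda>w. (c - w * c') / (1 - w))"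
  have g: "g w \<in> N - {c}" "c - g w = w * (c' - g w)" "c' - g w \<noteq> 0" if "w \<in> N" for w
  proof -
    have w: "w \<noteq> 0" "w \<notin> positive_elements" "1 - w \<noteq> 0"
      using that one_in_positive_elements by (auto simp: N_def)
    have eq1: "c - g w = w * (c' - c) / (1 - w)" "c' - g w = (c' - c) / (1 - w)"
      using w(3) by (auto simp: g_def field_simps)
    show prod: "c - g w = w * (c' - g w)" and nz: "c' - g w \<noteq> 0"
      using w neq unfolding eq1 by auto
    have "g w \<noteq> y\<^sup>2" for y
      using eq[of y] times_in_positive_elements_iff[OF odd w(1) nz] w(2) prod by auto
    hence "g w \<in> N" using power_zero_numeral by (auto simp: N_def positive_elements_def)
    thus "g w \<in> N - {c}" using prod nz w(1) by auto
  qed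
  have "inj_on g N"
  proof (rule inj_onI)
    fix w w' assume *: "w \<in> N" "w' \<in> N" "g w = g w'"
    have "w * (c' - g w) = w' * (c' - g w)" using g(2)[OF *(1)] g(2)[OF *(2)] *(3) by metis
    thus "w = w'" using g(3)[OF *(1)] by (metis mult_right_cancel)
  qed
  hence "card N \<le> card (N - {c})" using g(1) by (intro card_inj_on_le[of g]) auto
  moreover have "c \<in> N" using c by (simp add: N_def)
  ultimately show False using card_Diff1_less[of N c] by simp
qed

section \<open>Binomial coefficients and exponents modulo a prime power minus one\<close>

text \<open>
  One step of Lucas' theorem, which splits off the lowest digits in base \<open>p\<close>.  The induction step is
  Vandermonde's identity for \<open>p + (p * a + b)\<close>: modulo \<open>p\<close>, only the terms with \<open>p choose 0\<close> and
  \<open>p choose p\<close> survive, and what remains is Pascal's rule for \<open>a choose c\<close>.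
\<close>

lemma lucas_digit_step:
  assumes "prime p" "b < p" "d < p"
  shows "[(p * a + b) choose (p * c + d) = (a choose c) * (b choose d)] (mod p)"
proof (induction a arbitrary: c)
  case 0
  show ?case
  proof (cases c)
    case (Suc c')
    have "b < p * c + d" using assms Suc by (simp add: trans_less_add1)
    thus ?thesis using Suc by (simp add: binomial_eq_0)
  qed auto
next
  case (Suc a)
  define r where "r = p * c + d"
  define f where "f = (\<lambda>k. (p choose k) * ((p * a + b) choose (r - k)))"
  have "p > 0" using assms(1) prime_gt_0_nat by blast
  have "(p * Suc a + b) choose r = sum f {..r}"
    using vandermonde[of p "p * a + b" r] by (simp add: f_def algebra_simps)
  also have "[sum f {..r} = (\<Sum>k\<le>r. if k \<in> {0, p} then f k else 0)] (mod p)"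
  proof (rule cong_sum)
    fix k
    have "p dvd (p choose k)" if "k \<noteq> 0" "k \<noteq> p"
    proof (cases "k < p")
      case True
      thus ?thesis using that assms(1) by (intro dvd_choose_prime) auto
    qed (use that in \<open>simp add: binomial_eq_0\<close>)
    thus "[f k = (if k \<in> {0, p} then f k else 0)] (mod p)"
      by (auto simp: f_def cong_0_iff)
  qed
  also have "(\<Sum>k\<le>r. if k \<in> {0, p} then f k else 0) = sum f ({..r} \<inter> {0, p})"
    by (subst sum.inter_restrict) auto
  also have "[sum f ({..r} \<inter> {0, p}) = (Suc a choose c) * (b choose d)] (mod p)"
  proof (cases c)
    case 0
    hence "{..r} \<inter> {0, p} = {0}" using assms by (auto simp: r_def)
    hence "sum f ({..r} \<inter> {0, p}) = (p * a + b) choose (p * 0 + d)"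
      by (simp only:) (simp add: f_def r_def 0)
    thus ?thesis using Suc[of 0] 0 by simp
  next
    case (Suc c')
    hence "{..r} \<inter> {0, p} = {0, p}" "r - p = p * c' + d" by (auto simp: r_def)
    hence "sum f ({..r} \<inter> {0, p}) =
        ((p * a + b) choose (p * c + d)) + ((p * a + b) choose (p * c' + d))"
      using \<open>p > 0\<close> by (simp add: f_def r_def)
    also have "[\<dots> = (a choose c) * (b choose d) + (a choose c') * (b choose d)] (mod p)"
      by (intro cong_add Suc.IH)
    also have "(a choose c) * (b choose d) + (a choose c') * (b choose d) = (Suc a choose c) * (b choose d)"
      using Suc by (simp add: algebra_simps)
    finally show ?thesis .
  qed
  finally show ?case by (simp add: r_def)
qed

text \<open>
  Iterating \<open>lucas_digit_step\<close> leaves a product of binomial coefficients \<open>h choose d t\<close>, which divide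
  \<open>fact h\<close> and so are prime to \<open>p\<close>.
\<close>

lemma not_dvd_binomial_of_digits_le:
  assumes "prime p" "h < p" "\<And>t. d t \<le> h"
  shows "\<not> p dvd ((\<Sum>t<n. h * p ^ t) choose (\<Sum>t<n. d t * p ^ t))"
  using assms(3)
proof (induction n arbitrary: d)
  case 0
  thus ?case using assms(1) prime_gt_1_nat by fastforce
next
  case (Suc n)
  have "(\<Sum>t<Suc n. h * p ^ t) = p * (\<Sum>t<n. h * p ^ t) + h"
    by (simp add: sum.lessThan_Suc_shift sum_distrib_left algebra_simps del: sum.lessThan_Suc)
  moreover have "(\<Sum>t<Suc n. d t * p ^ t) = p * (\<Sum>t<n. d (Suc t) * p ^ t) + d 0"
    by (simp add: sum.lessThan_Suc_shift sum_distrib_left algebra_simps del: sum.lessThan_Suc)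
  ultimately have cong: "[((\<Sum>t<Suc n. h * p ^ t) choose (\<Sum>t<Suc n. d t * p ^ t)) =
      ((\<Sum>t<n. h * p ^ t) choose (\<Sum>t<n. d (Suc t) * p ^ t)) * (h choose d 0)] (mod p)"
    using lucas_digit_step[OF assms(1), of h "d 0"] assms(2) Suc.prems[of 0]
    by (metis le_less_trans)
  have "(h choose d 0) dvd fact h"
    using binomial_fact_lemma[OF Suc.prems[of 0]] by (metis dvd_triv_right)
  hence "\<not> p dvd (h choose d 0)"
    using assms(1,2) prime_dvd_fact_iff[of p h] dvd_trans leD by blast
  moreover have "\<not> p dvd ((\<Sum>t<n. h * p ^ t) choose (\<Sum>t<n. d (Suc t) * p ^ t))"
    using Suc.IH[of "\<lambda>t. d (Suc t)"] Suc.prems by simp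
  ultimately show ?case
    using cong_dvd_iff[OF cong] assms(1) by (simp add: prime_dvd_mult_iff del: sum.lessThan_Suc)
qed

text \<open>
  The arithmetic core of the additivity proof.  Write \<open>q = p ^ n\<close>, \<open>m = (q - 1) div 2\<close>,
  \<open>h = (p - 1) div 2\<close> and \<open>K t = k * p ^ t mod (q - 1)\<close>.  All digits of \<open>m\<close> in base \<open>p\<close> equal \<open>h\<close>,
  so by Lucas the assumption applies to all \<open>j\<close> whose digits are at most \<open>h\<close>.  Adding up the
  \<open>K t\<close> one at a time, one sees that the sums never wrap around modulo \<open>q - 1\<close>; in particular
  \<open>h * (\<Sum>t<n. K t) \<le> m\<close>, that is, \<open>(\<Sum>t<n. K t) \<le> 1 + p + ... + p ^ (n - 1)\<close>.  This sum is so small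
  that multiplication by \<open>p\<close> takes \<open>K t\<close> to \<open>K (t + 1)\<close> without reduction except at the
  maximal \<open>K t\<close>.  Hence \<open>K\<close> runs through \<open>r, p * r, ..., p ^ (n - 1) * r\<close> and the bound leaves only
  \<open>r = 1\<close>.
\<close>

lemma exponent_inverse_of_prime_power:
  fixes p k n :: nat
  assumes p: "prime p" "p \<noteq> 2" and n: "n \<ge> 1" and cop: "coprime k (p ^ n - 1)"
    and half: "\<And>j. \<not> p dvd (((p ^ n - 1) div 2) choose j) \<Longrightarrow>
                  (k * j) mod (p ^ n - 1) \<le> (p ^ n - 1) div 2"
  shows "\<exists>t. [k * p ^ t = 1] (mod p ^ n - 1)"
proof -
  define h where "h = (p - 1) div 2"
  define s where "s = (\<Sum>t<n. p ^ t)"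
  define m where "m = (p ^ n - 1) div 2"
  define K where "K = (\<lambda>t. (k * p ^ t) mod (2 * m))"
  have p3: "p \<ge> 3" using p prime_ge_2_nat[of p] by linarith
  have "odd p" using p prime_odd_nat p3 by auto
  hence h: "2 * h = p - 1" "h \<ge> 1" "h < p" using p3 by (auto simp: h_def)
  have "(p - 1) * s + 1 = p ^ n" unfolding s_def
  proof (induction n)
    case (Suc n)
    have "(p - 1) * (\<Sum>t<Suc n. p ^ t) + 1 = p ^ n + (p - 1) * p ^ n"
      using Suc by (simp add: distrib_left)
    also have "\<dots> = p ^ Suc n" using p3 by (cases p) auto
    finally show ?case .
  qed auto
  hence q: "p ^ n - 1 = (p - 1) * s" "p ^ n = (p - 1) * s + 1" by simp_all
  have m2: "p ^ n - 1 = 2 * m" unfolding m_def using q(1) h(1) by (metis dvd_mult2 dvd_mult_div_cancel dvd_triv_left)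
  have "2 * m = 2 * (h * s)" using m2 q(1) by (metis h(1) mult.assoc)
  hence ms: "m = h * s" by simp
  have ms': "m = (\<Sum>t<n. h * p ^ t)" using ms by (simp add: s_def sum_distrib_left)
  have m1: "m \<ge> 1"
  proof -
    have "p ^ 1 \<le> p ^ n" using n p3 by (intro power_increasing) auto
    thus ?thesis using m2 p3 by auto
  qed
  have not0: "\<not> 2 * m dvd k * j" if "0 < j" "j \<le> m" for j
  proof
    assume "2 * m dvd k * j"
    hence "2 * m dvd j" using cop m2 by (metis coprime_commute coprime_dvd_mult_right_iff)
    thus False using that m1 dvd_imp_le by fastforce
  qed
  \<comment> \<open>Induction on the digit sum.  Lowering one digit \<open>d t0\<close> by 1 gives a sum that is at most \<open>m\<close>, and
    \<open>K t0 \<le> m\<close>, so the new sum is at most \<open>2 * m\<close>.  It is not divisible by \<open>2 * m\<close> as \<open>k\<close> is coprime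
    to \<open>2 * m\<close>, so it equals its own residue, which is at most \<open>m\<close> by assumption.\<close>
  have est: "(\<Sum>t<n. d t * K t) \<le> m" if "\<And>t. d t \<le> h" for d
    using that
  proof (induction "\<Sum>t<n. d t" arbitrary: d)
    case 0
    thus ?case by simp
  next
    case (Suc N)
    have digit: "(k * (\<Sum>t<n. d t * p ^ t)) mod (2 * m) \<le> m" if "\<And>t. d t \<le> h" for d
      using half[of "\<Sum>t<n. d t * p ^ t"] not_dvd_binomial_of_digits_le[OF p(1) h(3), of d n] that
      unfolding m_def[symmetric] m2 ms'[symmetric] by simp
    have "\<exists>t0<n. d t0 \<noteq> 0"
    proof (rule ccontr)
      assume "\<not> ?thesis"
      hence "(\<Sum>t<n. d t) = 0" by simp
      thus False using Suc.hyps(2) by simp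
    qed
    then obtain t0 where t0: "t0 < n" "d t0 > 0" by auto
    define d' where "d' = d(t0 := d t0 - 1)"
    have split: "(\<Sum>t<n. d t * g t) = (\<Sum>t<n. d' t * g t) + g t0" for g :: "nat \<Rightarrow> nat"
    proof -
      have "(\<Sum>t<n. d t * g t) = d t0 * g t0 + (\<Sum>t\<in>{..<n}-{t0}. d t * g t)"
        using t0 by (subst sum.remove[of _ t0]) auto
      moreover have "(\<Sum>t<n. d' t * g t) = (d t0 - 1) * g t0 + (\<Sum>t\<in>{..<n}-{t0}. d t * g t)"
        using t0 by (subst sum.remove[of _ t0]) (auto simp: d'_def)
      moreover have "d t0 * g t0 = (d t0 - 1) * g t0 + g t0"
        using t0(2) by (cases "d t0") auto
      ultimately show ?thesis by simp
    qed
    have "N = (\<Sum>t<n. d' t)" using split[of "\<lambda>_. 1"] Suc.hyps(2) by simp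
    moreover have "d' t \<le> h" for t
      using Suc.prems[of t] by (auto simp: d'_def)
    ultimately have "(\<Sum>t<n. d' t * K t) \<le> m" by (rule Suc.hyps(1))
    moreover have "K t0 \<le> m"
    proof -
      have "(\<Sum>t<n. (if t = t0 then 1 else 0) * p ^ t) = p ^ t0"
        using t0(1) by (simp add: if_distrib[of "\<lambda>x. x * _"] cong: if_cong)
      thus ?thesis using digit[of "\<lambda>t. if t = t0 then 1 else 0"] h(2) by (simp add: K_def)
    qed
    ultimately have le: "(\<Sum>t<n. d t * K t) \<le> 2 * m" using split[of K] by simp
    have "[(\<Sum>t<n. d t * K t) = (\<Sum>t<n. d t * (k * p ^ t))] (mod 2 * m)"
      unfolding K_def by (intro cong_sum cong_mult) (auto simp: cong_def)
    also have "(\<Sum>t<n. d t * (k * p ^ t)) = k * (\<Sum>t<n. d t * p ^ t)"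
      by (simp add: sum_distrib_left algebra_simps)
    finally have cong: "[(\<Sum>t<n. d t * K t) = k * (\<Sum>t<n. d t * p ^ t)] (mod 2 * m)" .
    have "(\<Sum>t<n. d t * p ^ t) > 0"
      using split[of "\<lambda>t. p ^ t"] p3 by simp
    moreover have "(\<Sum>t<n. d t * p ^ t) \<le> m"
      unfolding ms' by (intro sum_mono mult_right_mono Suc.prems) auto
    ultimately have "\<not> 2 * m dvd (\<Sum>t<n. d t * K t)"
      using not0 cong cong_dvd_iff by blast
    hence "(\<Sum>t<n. d t * K t) < 2 * m" using le by (metis dvd_refl le_neq_implies_less)
    thus ?case using digit[OF Suc.prems] cong by (simp add: cong_def)
  qed
  have sumK: "(\<Sum>t<n. K t) \<le> s"
  proof -
    have "h * (\<Sum>t<n. K t) \<le> h * s" using est[of "\<lambda>_. h"] ms by (simp add: sum_distrib_left)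
    thus ?thesis using h(2) by simp
  qed
  have s1: "s \<ge> 1" using ms m1 by (cases s) auto
  have Kstep: "K (Suc t) = (p * K t) mod (2 * m)" for t
    by (simp add: K_def mod_mult_right_eq mult.left_commute)
  have qmod: "[p ^ n = 1] (mod 2 * m)"
  proof -
    have "p ^ n = 2 * m + 1" using q m2 by simp
    thus ?thesis by (simp only: cong_def mod_add_self1)
  qed
  have Kper: "K (t + n) = K t" for t
  proof -
    have "[k * p ^ t * p ^ n = k * p ^ t * 1] (mod 2 * m)" using qmod by (intro cong_mult) auto
    thus ?thesis by (simp add: K_def cong_def power_add mult.assoc)
  qed
  have "0 \<in> {..<n}" using n by simp
  hence "K ` {..<n} \<noteq> {}" by blast
  then obtain t0 where t0: "t0 < n" "\<And>t. t < n \<Longrightarrow> K t \<le> K t0"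
    using Max_in[of "K ` {..<n}"] Max_ge[of "K ` {..<n}"] by (metis (no_types, lifting) finite_imageI finite_lessThan image_eqI imageE lessThan_iff)
  have K_mod: "K t = K (t mod n)" for t
  proof -
    have "K (r + i * n) = K r" for r i
    proof (induction i)
      case (Suc i)
      thus ?case using Kper[of "r + i * n"] by (simp add: algebra_simps)
    qed auto
    from this[of "t mod n" "t div n"] show ?thesis by simp
  qed
  \<comment> \<open>A non-maximal \<open>K t\<close> is at most half of the whole sum, that is, at most \<open>s div 2\<close>.  Here
    \<open>p > 2\<close> is essential.\<close>
  have small: "p * K t < 2 * m" if "t < n" "t \<noteq> t0" for t
  proof -
    have "K t + K t0 = sum K {t, t0}" using that by simp
    also have "\<dots> \<le> sum K {..<n}" using that t0(1) by (intro sum_mono2) auto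
    finally have "2 * K t \<le> s" using t0(2)[OF that(1)] sumK by linarith
    hence "2 * (p * K t) \<le> p * s" by (metis mult.left_commute mult_le_mono2)
    also have "p * s < 2 * ((p - 1) * s)"
    proof -
      have "p < 2 * (p - 1)" using p3 by linarith
      hence "p * s < 2 * (p - 1) * s" using s1 by (intro mult_less_mono1) auto
      thus ?thesis by (simp only: mult.assoc)
    qed
    finally show ?thesis using q(1) m2 by simp
  qed
  \<comment> \<open>Start right after the maximum, so that the next \<open>n - 1\<close> steps are honest multiplications
    by \<open>p\<close>.\<close>
  define r where "r = K (Suc t0)"
  have iter: "K (Suc t0 + i) = p ^ i * r" if "i < n" for i
    using that
  proof (induction i)
    case (Suc i)
    define t where "t = (Suc t0 + i) mod n"
    have "t \<noteq> t0"
    proof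
      assume "t = t0"
      hence "[t0 + Suc i = t0 + 0] (mod n)" using t0(1) by (simp add: t_def cong_def)
      hence "n dvd Suc i" by (simp only: cong_add_lcancel_nat cong_0_iff)
      thus False using Suc.prems by (auto dest: dvd_imp_le)
    qed
    hence "p * K (Suc t0 + i) < 2 * m"
      using small[of t] K_mod[of "Suc t0 + i"] n by (simp add: t_def)
    hence "K (Suc (Suc t0 + i)) = p * K (Suc t0 + i)" unfolding Kstep by simp
    thus ?case using Suc by simp
  qed (simp add: r_def)
  have "r > 0"
  proof -
    have "[k * p ^ Suc t0 = r] (mod 2 * m)" by (simp add: r_def K_def cong_def)
    moreover have "coprime (k * p ^ Suc t0) (2 * m)"
    proof -
      have "coprime (p ^ n) (2 * m)" using qmod cong_imp_coprime cong_sym coprime_1_left by blast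
      hence "coprime p (2 * m)" using n by simp
      thus ?thesis using cop m2 by simp
    qed
    ultimately have "coprime r (2 * m)" using cong_imp_coprime by blast
    thus ?thesis using m1 by (cases r) auto
  qed
  have "p ^ (n - 1) * r = K t0"
    using iter[of "n - 1"] n Kper[of t0] by simp
  also have "\<dots> \<le> s"
    using sumK member_le_sum[of t0 "{..<n}" K] t0(1) by simp
  finally have le: "p ^ (n - 1) * r \<le> s" .
  have "p ^ n = p * p ^ (n - 1)" using n by (cases n) auto
  moreover have "(p - 1) * s < p ^ n" using q(2) by simp
  moreover have "p * p ^ (n - 1) \<le> (p - 1) * (2 * p ^ (n - 1))"
  proof -
    have "p \<le> (p - 1) * 2" using p3 by linarith
    thus ?thesis by (metis mult.assoc mult_le_mono1)
  qed
  ultimately have "(p - 1) * s < (p - 1) * (2 * p ^ (n - 1))" by linarith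
  hence "s < 2 * p ^ (n - 1)" by simp
  with le have "p ^ (n - 1) * r < p ^ (n - 1) * 2" by (metis le_less_trans mult.commute)
  hence "r < 2" by simp
  hence "r = 1" using \<open>r > 0\<close> by auto
  hence "[k * p ^ Suc t0 = 1] (mod p ^ n - 1)"
    using m2 m1 by (simp add: r_def K_def cong_def)
  thus ?thesis by blast
qed

section \<open>Additivity of power maps\<close>

text \<open>
  A multiplicative injection has the form \<open>f x = x ^ k\<close>.  By Euler's criterion, \<open>diff\<close> says that
  \<open>(x ^ k - 1) ^ m = (x - 1) ^ m\<close> for all \<open>x\<close>, where \<open>m = (q - 1) div 2\<close>.  Expand the left-hand side
  and reduce the exponents \<open>k * j\<close> modulo \<open>q - 1\<close>; they stay distinct as \<open>k\<close> is coprime to \<open>q - 1\<close>.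
  Both sides are then polynomials of degree below \<open>q - 1\<close> that agree at all nonzero elements, so they
  coincide, and an exponent \<open>k * j mod (q - 1)\<close> with \<open>m choose j\<close> nonzero modulo \<open>p\<close> is at most the
  degree \<open>m\<close> of the right-hand side.  By \<open>exponent_inverse_of_prime_power\<close>, this makes \<open>f\<close> the inverse of a
  power of the Frobenius automorphism.
\<close>

lemma multiplicative_square_difference_preserver_additive:
  fixes f :: "'a::{field,finite} \<Rightarrow> 'a"
  assumes odd: "odd CARD('a)" and mult: "\<And>x y. f (x * y) = f x * f y" and inj: "inj f"
    and diff: "\<And>c. c - 1 \<in> positive_elements \<longleftrightarrow> f c - 1 \<in> positive_elements"
  shows "f (x + y) = f x + f y"
proof -
  define N where "N = CARD('a) - 1"
  define m where "m = N div 2"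
  have N: "N = 2 * m" using odd by (simp add: m_def N_def)
  have "CARD('a) > 1" by (rule card_field_gt_1)
  hence m1: "m \<ge> 1" using N by (cases m) (auto simp: N_def)
  obtain k where k: "1 \<le> k" "coprime k N" "\<And>x. f x = x ^ k"
    using multiplicative_injection_is_power[OF mult inj] unfolding N_def by metis
  obtain n where n: "n \<ge> 1" "prime CHAR('a)" "CARD('a) = CHAR('a) ^ n"
    by (rule card_finite_field_prime_power)
  have p2: "CHAR('a) \<noteq> 2" using odd n(1,3) by auto
  have cardN: "card (UNIV - {0::'a}) = N" by (simp add: N_def)
  have powN: "x ^ N = 1" if "x \<noteq> 0" for x :: 'a
    using finite_field_nonzero_power_eq_1[OF that] by (simp add: N_def)
  have f1: "f 1 = 1" by (simp add: k(3))
  have euler: "(f x - 1) ^ m = (x - 1) ^ m" for x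
  proof (cases "x = 1")
    case True
    thus ?thesis by (simp add: f1)
  next
    case False
    hence "f x - 1 \<noteq> 0" "x - 1 \<noteq> 0" using injD[OF inj, of x 1] f1 by auto
    thus ?thesis
      using euler_criterion[OF odd, of "x - 1"] euler_criterion[OF odd, of "f x - 1"] diff[of x]
      unfolding m_def N_def by simp
  qed
  have half: "(k * j) mod N \<le> m" if j: "\<not> CHAR('a) dvd (m choose j)" for j
  proof -
    define c where "c = (\<lambda>j. of_nat (m choose j) * (- 1) ^ (m - j) :: 'a)"
    define A where "A = (\<Sum>j\<le>m. Polynomial.monom (c j) ((k * j) mod N))"
    define B where "B = [:- 1, 1 :: 'a:] ^ m"
    have jm: "j \<le> m" using j by (metis binomial_eq_0 dvd_0_right not_less)
    have degB: "degree B = m" by (simp add: B_def degree_linear_power)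
    have "A = B"
    proof (rule poly_eqI_degree)
      fix x :: 'a assume "x \<in> UNIV - {0}"
      hence x: "x ^ N = 1" using powN by simp
      have red: "x ^ ((k * j) mod N) = (x ^ k) ^ j" for j
      proof -
        have "(x ^ k) ^ j = x ^ (N * ((k * j) div N) + (k * j) mod N)" by (simp flip: power_mult)
        thus ?thesis unfolding power_add power_mult x by simp
      qed
      have "poly A x = (\<Sum>j\<le>m. of_nat (m choose j) * (x ^ k) ^ j * (- 1) ^ (m - j))"
        by (simp add: A_def poly_sum poly_monom red c_def) (simp add: mult_ac)
      also have "\<dots> = (x ^ k + (- 1)) ^ m" by (rule binomial_ring [symmetric])
      also have "\<dots> = (x - 1) ^ m" using euler[of x] by (simp add: k(3))
      also have "\<dots> = poly B x" by (simp add: B_def poly_power)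
      finally show "poly A x = poly B x" .
    next
      have "degree A \<le> N - 1" unfolding A_def
      proof (rule degree_sum_le)
        fix j
        have "(k * j) mod N < N" using N m1 by simp
        hence "(k * j) mod N \<le> N - 1" by linarith
        thus "degree (Polynomial.monom (c j) ((k * j) mod N)) \<le> N - 1"
          using degree_monom_le order_trans by blast
      qed simp
      thus "degree A < card (UNIV - {0::'a})" unfolding cardN using N m1 by simp
      show "degree B < card (UNIV - {0::'a})" unfolding cardN using N m1 degB by simp
    qed
    have "Polynomial.coeff A ((k * j) mod N) = (\<Sum>i\<le>m. if i = j then c i else 0)"
      unfolding A_def coeff_sum
    proof (rule sum.cong)
      fix i assume i: "i \<in> {..m}"
      have "(k * i) mod N = (k * j) mod N \<longleftrightarrow> [i = j] (mod N)"
        using cong_mult_lcancel_nat[of k N i j] k(2) by (simp add: cong_def)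
      also have "\<dots> \<longleftrightarrow> i = j" using i jm N m1 by (simp add: cong_def)
      finally show "Polynomial.coeff (Polynomial.monom (c i) (k * i mod N)) (k * j mod N) = (if i = j then c i else 0)"
        by simp
    qed simp
    also have "\<dots> = c j" using jm by simp
    finally have "Polynomial.coeff B ((k * j) mod N) = c j" using \<open>A = B\<close> by simp
    moreover have "c j \<noteq> 0" using j by (simp add: c_def of_nat_eq_0_iff_char_dvd)
    ultimately show ?thesis using le_degree degB by metis
  qed
  have N': "CHAR('a) ^ n - 1 = N" using n(3) by (simp add: N_def)
  obtain t where t: "[k * CHAR('a) ^ t = 1] (mod N)"
    using exponent_inverse_of_prime_power[OF n(2) p2 n(1), of k] k(2) half
    unfolding N' m_def[symmetric] by blast
  define r where "r = CHAR('a) ^ t"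
  have r: "(f x) ^ r = x" for x
  proof (cases "x = 0")
    case True
    thus ?thesis using k n(2) prime_gt_0_nat by (simp add: r_def power_0_left)
  next
    case False
    have "0 < k * r" using k(1) prime_gt_0_nat[OF n(2)] by (simp add: r_def)
    hence "1 \<le> k * r" by linarith
    moreover have "[k * r = 1] (mod N)" using t by (simp only: r_def)
    ultimately obtain i where "k * r = i * N + 1" using cong_le_nat[of 1 "k * r" N] by blast
    hence i: "k * r = 1 + N * i" by simp
    have "(f x) ^ r = x ^ (k * r)" by (simp add: k(3) power_mult)
    also have "\<dots> = x" unfolding i power_add power_mult powN[OF False] by simp
    finally show ?thesis .
  qed
  have "surj f" using inj by (simp add: finite_UNIV_inj_surj)
  then obtain z where z: "f x + f y = f z" by (metis surjD)
  have "z = (f x + f y) ^ r" unfolding z by (rule r [symmetric])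
  also have "\<dots> = (f x) ^ r + (f y) ^ r" using n(2) by (rule freshmans_dream') (simp add: r_def)
  also have "\<dots> = x + y" unfolding r ..
  finally show ?thesis using z by simp
qed

section \<open>Multiplicativity of normalised sign preservers\<close>

text \<open>
  Let \<open>P\<close> be the set of nonzero squares.  Dividing by \<open>a\<close> and \<open>f a\<close>, the assumption says that
  \<open>f\<close> maps the translate \<open>P + b\<^sup>2 / a\<close> to \<open>P + (f b)\<^sup>2 / f a\<close>, in the sense of \<open>pres_quot\<close> below.  As distinct
  translates of \<open>P\<close> are distinct sets, \<open>(f b)\<^sup>2 / f a\<close> depends only on \<open>b\<^sup>2 / a\<close>, which
  yields multiplicativity on \<open>P\<close>; the same fact separates two elements of \<open>P\<close>.  Nonsquares are handled by
  \<open>nonsquare_determined_by_square_differences\<close>.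
\<close>

lemma normalized_sign_preserver_multiplicative:
  fixes f :: "'a::{field,finite} \<Rightarrow> 'a"
  assumes odd: "odd CARD('a)" and f1: "f 1 = 1"
    and pres: "\<And>a b c. a \<in> positive_elements \<and> a * c - b\<^sup>2 \<in> positive_elements \<longleftrightarrow>
        f a \<in> positive_elements \<and> f a * f c - (f b)\<^sup>2 \<in> positive_elements"
  shows "inj f" and "f (x * y) = f x * f y"
proof -
  let ?P = "positive_elements :: 'a set"
  note mult_iff = times_in_positive_elements_iff[OF odd]
  note one = one_in_positive_elements[where 'a='a]
  have nz: "a \<noteq> 0" if "a \<in> ?P" for a using that zero_notin_positive_elements by auto
  have fP: "f a \<in> ?P" if "a \<in> ?P" for a
    using pres[of a 1 0] that by simp
  have pres_pos: "a * c - b\<^sup>2 \<in> ?P \<longleftrightarrow> f a * f c - (f b)\<^sup>2 \<in> ?P" if "a \<in> ?P" for a b c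
    using pres[of a c b] that fP by blast
  have pres_one: "c - b\<^sup>2 \<in> ?P \<longleftrightarrow> f c - (f b)\<^sup>2 \<in> ?P" for b c
    using pres_pos[OF one, of c b] f1 by simp
  have pres_quot: "c - b\<^sup>2 / a \<in> ?P \<longleftrightarrow> f c - (f b)\<^sup>2 / f a \<in> ?P" if a: "a \<in> ?P" for a b c
  proof -
    have scale: "z - w / s \<in> ?P \<longleftrightarrow> s * z - w \<in> ?P" if "s \<in> ?P" for s z w :: 'a
    proof -
      have "s * z - w = s * (z - w / s)" using nz[OF that] by (simp add: field_simps)
      thus ?thesis using mult_iff[of s "z - w / s"] nz[OF that] that zero_notin_positive_elements
        by (cases "z - w / s = 0") auto
    qed
    show ?thesis unfolding scale[OF a] scale[OF fP[OF a]] by (rule pres_pos[OF a])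
  qed
  have inj_nonsq: "c = c'" if "f c = f c'" "c \<noteq> 0" "c \<notin> ?P" for c c'
  proof (rule nonsquare_determined_by_square_differences[OF odd that(2,3)])
    show "c - y\<^sup>2 \<in> ?P \<longleftrightarrow> c' - y\<^sup>2 \<in> ?P" for y
      using pres_one[of c y] pres_one[of c' y] that(1) by simp
  qed
  show inj: "inj f"
  proof (rule injI)
    fix c c' assume eq: "f c = f c'"
    have "c \<in> ?P \<longleftrightarrow> c' \<in> ?P" using pres_one[of c 0] pres_one[of c' 0] eq by simp
    \<comment> \<open>Two squares are separated by their role as the upper left entry: for \<open>b = 1\<close>, the translates
      \<open>P + 1 / c\<close> and \<open>P + 1 / c'\<close> are both preimages of \<open>P + 1 / f c\<close>.\<close>
    moreover have "c = c'" if c: "c \<in> ?P" "c' \<in> ?P"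
    proof -
      have "1 / c = 1 / c'"
      proof (rule positive_elements_translate_eqD[OF odd])
        show "x - 1 / c \<in> ?P \<longleftrightarrow> x - 1 / c' \<in> ?P" for x
          using pres_quot[OF c(1), of x 1] pres_quot[OF c(2), of x 1] eq by simp
      qed
      thus ?thesis by simp
    qed
    ultimately show "c = c'" using inj_nonsq[of c c'] inj_nonsq[of c' c] eq by metis
  qed
  hence surj: "surj f" by (simp add: finite_UNIV_inj_surj)
  have "f ` ?P = ?P"
  proof (rule card_subset_eq)
    show "card (f ` ?P) = card ?P" using inj by (simp add: card_image inj_on_subset)
  qed (use fP in auto)
  hence fP_iff: "f c \<in> ?P \<longleftrightarrow> c \<in> ?P" for c using inj_image_mem_iff[OF inj] by metis
  have "(f 0)\<^sup>2 = 0"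
  proof (rule positive_elements_translate_eqD[OF odd])
    fix x
    obtain c where "x = f c" using surj by (rule surjE)
    thus "x - (f 0)\<^sup>2 \<in> ?P \<longleftrightarrow> x - 0 \<in> ?P" using pres_one[of c 0] fP_iff by simp
  qed
  hence f0: "f 0 = 0" by simp
  have quot: "(f b)\<^sup>2 / f a = (f b')\<^sup>2 / f a'"
    if "a \<in> ?P" "a' \<in> ?P" "b\<^sup>2 / a = b'\<^sup>2 / a'" for a a' b b'
  proof (rule positive_elements_translate_eqD[OF odd])
    fix x
    obtain c where "x = f c" using surj by (rule surjE)
    thus "x - (f b)\<^sup>2 / f a \<in> ?P \<longleftrightarrow> x - (f b')\<^sup>2 / f a' \<in> ?P"
      using pres_quot[OF that(1), of c b] pres_quot[OF that(2), of c b'] that(3) by simp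
  qed
  have sq: "f (b\<^sup>2) = (f b)\<^sup>2" for b
  proof (cases "b = 0")
    case False
    hence b: "b\<^sup>2 \<in> ?P" by (rule power2_in_positive_elements)
    have "(f (b\<^sup>2))\<^sup>2 / f (b\<^sup>2) = (f b)\<^sup>2 / f 1"
      using b one False by (intro quot) (auto simp: power2_eq_square)
    thus ?thesis using nz[OF fP[OF b]] f1 by (simp add: power2_eq_square)
  qed (simp add: f0)
  have multP: "f (a * d) = f a * f d" if "a \<in> ?P" for a d
  proof -
    consider "d = 0" | "d \<in> ?P" | "d \<noteq> 0" "d \<notin> ?P" by blast
    thus ?thesis
    proof cases
      case 2
      have "a * d \<in> ?P" using mult_iff[of a d] nz that 2 by simp
      then obtain b where b: "a * d = b\<^sup>2" by (auto simp: positive_elements_def)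
      have "b\<^sup>2 / a = d\<^sup>2 / d"
        unfolding b[symmetric] using nz[OF that] nz[OF 2] by (simp add: power2_eq_square)
      hence "(f b)\<^sup>2 / f a = (f d)\<^sup>2 / f d" by (rule quot[OF that 2])
      thus ?thesis unfolding b sq using nz[OF fP[OF that]] nz[OF fP[OF 2]]
        by (simp add: field_simps power2_eq_square)
    next
      case 3
      show ?thesis
      proof (rule nonsquare_determined_by_square_differences[OF odd])
        have "a * d \<noteq> 0" "a * d \<notin> ?P" using mult_iff[of a d] nz[OF that] that 3 by auto
        thus "f (a * d) \<noteq> 0" "f (a * d) \<notin> ?P" using fP_iff injD[OF inj, of "a * d" 0] f0 by auto
        fix y
        obtain b where "y = f b" using surj by (rule surjE)
        thus "f (a * d) - y\<^sup>2 \<in> ?P \<longleftrightarrow> f a * f d - y\<^sup>2 \<in> ?P"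
          using pres_one[of "a * d" b] pres_pos[OF that, of d b] by simp
      qed
    qed (simp add: f0)
  qed
  show "f (x * y) = f x * f y"
  proof (cases "x = 0 \<or> y = 0 \<or> x \<in> ?P \<or> y \<in> ?P")
    case True
    thus ?thesis using multP[of x y] multP[of y x] by (auto simp: f0 mult.commute)
  next
    \<comment> \<open>For two nonsquares, the quotient is a square, which reduces the claim to the previous case.\<close>
    case False
    hence q: "y / x \<in> ?P" using divide_in_positive_elements_iff[OF odd, of y x] by auto
    have x2: "x\<^sup>2 \<in> ?P" using False by (simp add: power2_in_positive_elements)
    have "f (x * y) = f (x\<^sup>2 * (y / x))" using False by (simp add: power2_eq_square)
    also have "\<dots> = (f x)\<^sup>2 * f (y / x)" by (simp only: multP[OF x2] sq)
    also have "\<dots> = f x * f ((y / x) * x)" by (simp only: multP[OF q]) (simp add: power2_eq_square)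
    also have "\<dots> = f x * f y" using False by simp
    finally show ?thesis .
  qed
qed

section \<open>Positive definite matrices of size two\<close>

definition symmetric_2x2 :: "'a \<Rightarrow> 'a \<Rightarrow> 'a \<Rightarrow> 'a mat" where
  "symmetric_2x2 a b c = mat 2 2 (\<lambda>(i, j). if i \<noteq> j then b else if i = 0 then a else c)"

lemma symmetric_matrix_2_iff: "symmetric_matrix 2 A \<longleftrightarrow> (\<exists>a b c. A = symmetric_2x2 a b c)"
proof
  assume A: "symmetric_matrix 2 A"
  hence dim: "A \<in> carrier_mat 2 2" and tr: "transpose_mat A = A" by (auto simp: symmetric_matrix_def)
  have "A $$ (1, 0) = transpose_mat A $$ (0, 1)" using dim by (subst index_transpose_mat) auto
  hence "A $$ (1, 0) = A $$ (0, 1)" using tr by simp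
  hence "A = symmetric_2x2 (A $$ (0, 0)) (A $$ (0, 1)) (A $$ (1, 1))"
    using dim by (intro eq_matI) (auto simp: symmetric_2x2_def less_2_cases_iff)
  thus "\<exists>a b c. A = symmetric_2x2 a b c" by blast
next
  assume "\<exists>a b c. A = symmetric_2x2 a b c"
  thus "symmetric_matrix 2 A" by (auto simp: symmetric_matrix_def symmetric_2x2_def intro!: eq_matI)
qed

lemma map_mat_symmetric_2x2: "map_mat f (symmetric_2x2 a b c) = symmetric_2x2 (f a) (f b) (f c)"
  by (rule eq_matI) (auto simp: symmetric_2x2_def)

lemma leading_principal_minors_symmetric_2x2:
  fixes a b c :: "'a::comm_ring_1"
  shows "leading_principal_minor (symmetric_2x2 a b c) 1 = a"
    and "leading_principal_minor (symmetric_2x2 a b c) 2 = a * c - b\<^sup>2"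
proof -
  have pick: "pick {..<k} i = i" if "i < k" for i k :: nat
  proof -
    have "{a \<in> {..<k}. a < i} = {..<i}" using that by auto
    thus ?thesis using pick_card_in_set[of i "{..<k}"] that by simp
  qed
  have sub: "submatrix (symmetric_2x2 a b c) {..<k} {..<k} =
      mat k k (\<lambda>(i, j). symmetric_2x2 a b c $$ (i, j))" if "k \<le> 2" for k
  proof -
    have "{i. i < 2 \<and> i \<in> {..<k}} = {..<k}" using that by auto
    thus ?thesis
      by (intro eq_matI) (auto simp: submatrix_def symmetric_2x2_def pick)
  qed
  show "leading_principal_minor (symmetric_2x2 a b c) 1 = a"
    unfolding leading_principal_minor_def
    by (subst sub, simp, subst det_single) (auto simp: symmetric_2x2_def)
  have S: "symmetric_2x2 a b c \<in> carrier_mat 2 2" by (simp add: symmetric_2x2_def)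
  have "submatrix (symmetric_2x2 a b c) {..<2} {..<2} = symmetric_2x2 a b c"
    by (subst sub) (auto simp: symmetric_2x2_def)
  moreover have "det (symmetric_2x2 a b c) = a * c - b\<^sup>2"
  proof -
    have det1: "det (mat (Suc 0) (Suc 0) g) = g (0, 0)" for g :: "nat \<times> nat \<Rightarrow> 'a"
      by (subst det_single) auto
    show ?thesis
      by (subst laplace_expansion_row[OF S, of 0])
        (auto simp: cofactor_def det1 lessThan_Suc numeral_2_eq_2 mat_delete_def
          symmetric_2x2_def power2_eq_square)
  qed
  ultimately show "leading_principal_minor (symmetric_2x2 a b c) 2 = a * c - b\<^sup>2"
    by (simp add: leading_principal_minor_def)
qed

lemma positive_definite_symmetric_2x2_iff:
  "positive_definite_matrix 2 (symmetric_2x2 a b c) \<longleftrightarrow>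
     a \<in> positive_elements \<and> a * c - b\<^sup>2 \<in> positive_elements"
proof -
  have "{1..2::nat} = {1, 2}" by auto
  thus ?thesis
    using symmetric_matrix_2_iff[of "symmetric_2x2 a b c"]
    by (auto simp: positive_definite_matrix_def leading_principal_minors_symmetric_2x2[simplified])
qed

lemma sign_preserver_2_iff:
  "sign_preserver 2 f \<longleftrightarrow>
     (\<forall>a b c. a \<in> positive_elements \<and> a * c - b\<^sup>2 \<in> positive_elements \<longleftrightarrow>
        f a \<in> positive_elements \<and> f a * f c - (f b)\<^sup>2 \<in> positive_elements)"
proof -
  have "sign_preserver 2 f \<longleftrightarrow> (\<forall>a b c. positive_definite_matrix 2 (symmetric_2x2 a b c) \<longleftrightarrow>
      positive_definite_matrix 2 (map_mat f (symmetric_2x2 a b c)))"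
    unfolding sign_preserver_def symmetric_matrix_2_iff by blast
  thus ?thesis unfolding map_mat_symmetric_2x2 positive_definite_symmetric_2x2_iff .
qed

lemma times_positive_in_positive_elements_iff:
  fixes c x :: "'a::field"
  assumes "c \<in> positive_elements"
  shows "c * x \<in> positive_elements \<longleftrightarrow> x \<in> positive_elements"
proof -
  obtain y where y: "y \<noteq> 0" "c = y\<^sup>2" using assms by (auto simp: positive_elements_def)
  have "c * x = z\<^sup>2 \<longleftrightarrow> x = (z / y)\<^sup>2" for z using y by (auto simp: field_simps)
  moreover have "x = z\<^sup>2 \<longleftrightarrow> c * x = (z * y)\<^sup>2" for z using y by (auto simp: field_simps)
  ultimately show ?thesis using y(1) unfolding positive_elements_def
    by (smt (verit, best) divide_eq_0_iff mem_Collect_eq mult_eq_0_iff)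
qed

lemma sign_preserver_2_scale:
  fixes f :: "'a::field \<Rightarrow> 'a"
  assumes c: "c \<in> positive_elements"
  shows "sign_preserver 2 (\<lambda>x. c * f x) \<longleftrightarrow> sign_preserver 2 f"
proof -
  have "(c * x) * (c * z) - (c * y)\<^sup>2 = c * (c * (x * z - y\<^sup>2))" for x y z
    by (simp add: algebra_simps power2_eq_square)
  thus ?thesis unfolding sign_preserver_2_iff
    by (simp only: times_positive_in_positive_elements_iff[OF c])
qed

section \<open>The two characterisations\<close>

lemma positive_elements_even_card:
  assumes "even CARD('a::{field,finite})"
  shows "(positive_elements :: 'a set) = UNIV - {0}"
proof -
  have "inj (\<lambda>x::'a. x ^ 2)"
    using assms by (intro inj_power_of_coprime) auto
  hence surj: "surj (\<lambda>x::'a. x\<^sup>2)" by (simp add: finite_UNIV_inj_surj)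
  have "x \<in> positive_elements" if "x \<noteq> 0" for x :: 'a
  proof -
    obtain y where "x = y\<^sup>2" using surj by (rule surjE)
    thus ?thesis using that by (intro power2_in_positive_elements[of y, folded \<open>x = y\<^sup>2\<close>]) auto
  qed
  thus ?thesis using zero_notin_positive_elements by auto
qed

text \<open>
  For even \<open>q\<close>, squaring is bijective, so positive definiteness of \<open>symmetric_2x2 a b c\<close> means
  \<open>a \<noteq> 0\<close> and \<open>a * c \<noteq> b\<^sup>2\<close>.  A sign preserver therefore preserves and reflects the relation
  \<open>a * c = b\<^sup>2\<close>, and after division by \<open>f 1\<close> this makes it multiplicative and injective.
\<close>

lemma sign_preservers_2_even:
  assumes even: "even CARD('a::{field,finite})"
  shows "{f :: 'a \<Rightarrow> 'a. sign_preserver 2 f} = bijective_monomials"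
proof (intro subset_antisym subsetI)
  note P = positive_elements_even_card[OF even]
  fix f :: "'a \<Rightarrow> 'a" assume "f \<in> {f. sign_preserver 2 f}"
  hence pres: "a \<noteq> 0 \<and> a * c \<noteq> b\<^sup>2 \<longleftrightarrow> f a \<noteq> 0 \<and> f a * f c \<noteq> (f b)\<^sup>2" for a b c
    by (simp add: sign_preserver_2_iff P)
  have nz: "f a \<noteq> 0" if "a \<noteq> 0" for a
    using pres[of a 1 0] that by simp
  have f0: "f 0 = 0"
  proof (rule ccontr)
    assume "f 0 \<noteq> 0"
    moreover from this have "f 0 * f 1 = (f 1)\<^sup>2" using pres[of 0 1 1] by simp
    ultimately have "f 0 = f 1" using nz[of 1] by (simp add: power2_eq_square)
    thus False using pres[of 1 1 0] by (simp add: power2_eq_square)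
  qed
  have prod: "f a * f c = (f b)\<^sup>2 \<longleftrightarrow> a * c = b\<^sup>2" for a b c
    using pres[of a c b] nz[of a] nz[of b] f0 by (cases "a = 0"; cases "b = 0") auto
  define g where "g = (\<lambda>x. f x / f 1)"
  have f1: "f 1 \<noteq> 0" using nz by simp
  have g_prod: "g a * g c = (g b)\<^sup>2 \<longleftrightarrow> a * c = b\<^sup>2" for a b c
    using f1 by (simp add: g_def prod power_divide power2_eq_square[of "f 1"])
  have g1: "g 1 = 1" using f1 by (simp add: g_def)
  have "g (x * y) = g x * g y" for x y
  proof -
    have "\<exists>b. x * y = b\<^sup>2"
    proof (cases "x * y = 0")
      case True
      thus ?thesis by (intro exI[of _ 0]) simp
    next
      case False
      hence "x * y \<in> positive_elements" unfolding P by simp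
      thus ?thesis unfolding positive_elements_def by blast
    qed
    then obtain b where b: "x * y = b\<^sup>2" ..
    have "g 1 * g (x * y) = (g b)\<^sup>2" using g_prod[of 1 "x * y" b] b by simp
    also have "\<dots> = g x * g y" using g_prod[of x y b] b by simp
    finally show ?thesis by (simp add: g1)
  qed
  moreover have "inj g"
  proof (rule injI)
    fix a c assume "g a = g c"
    hence "g a * g c = (g a)\<^sup>2" "g a * g c = (g c)\<^sup>2" by (simp_all add: power2_eq_square)
    hence "a * c = a\<^sup>2" "a * c = c\<^sup>2" unfolding g_prod .
    thus "a = c" by (cases "a = 0") (auto simp: power2_eq_square)
  qed
  ultimately obtain n where n: "1 \<le> n" "n \<le> CARD('a) - 1" "coprime n (CARD('a) - 1)"
      "\<And>x. g x = x ^ n"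
    using multiplicative_injection_is_power by blast
  have "f x = f 1 * x ^ n" for x
    unfolding n(4)[symmetric] using f1 by (simp add: g_def)
  hence "f = (\<lambda>x. f 1 * x ^ n)" by (rule ext)
  thus "f \<in> bijective_monomials"
    using n(1-3) f1 unfolding bijective_monomials_def coprime_iff_gcd_eq_1
    by (intro CollectI exI[of _ "f 1"] exI[of _ n] conjI)
next
  note P = positive_elements_even_card[OF even]
  fix f :: "'a \<Rightarrow> 'a" assume "f \<in> bijective_monomials"
  then obtain c n where f: "f = (\<lambda>x. c * x ^ n)" "c \<noteq> 0" "1 \<le> n" "coprime n (CARD('a) - 1)"
    unfolding bijective_monomials_def coprime_iff_gcd_eq_1 mem_Collect_eq by (elim exE conjE)
  have inj: "inj (\<lambda>x::'a. x ^ n)" using f by (intro inj_power_of_coprime)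
  have "f a * f d = (f b)\<^sup>2 \<longleftrightarrow> a * d = b\<^sup>2" for a b d
  proof -
    have "f a * f d = (f b)\<^sup>2 \<longleftrightarrow> c\<^sup>2 * (a * d) ^ n = c\<^sup>2 * (b\<^sup>2) ^ n"
      by (simp add: f(1) power_mult_distrib power2_eq_square mult_ac)
    also have "\<dots> \<longleftrightarrow> a * d = b\<^sup>2" using f(2) inj_eq[OF inj] by simp
    finally show ?thesis .
  qed
  moreover have "f a = 0 \<longleftrightarrow> a = 0" for a using f(2,3) by (simp add: f(1))
  ultimately show "f \<in> {f. sign_preserver 2 f}" by (simp add: sign_preserver_2_iff P)
qed

text \<open>
  After division by \<open>f 1\<close>, a sign preserver is multiplicative and injective, and the matrices with
  \<open>a = b = 1\<close> show that it also preserves and reflects the property that \<open>x - 1\<close> is a nonzero square;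
  so it is additive.
\<close>

lemma sign_preservers_2_odd:
  assumes odd: "odd CARD('a::{field,finite})"
  shows "{f :: 'a \<Rightarrow> 'a. sign_preserver 2 f} = positive_multiples_of_automorphisms"
proof (intro subset_antisym subsetI)
  fix f :: "'a \<Rightarrow> 'a" assume "f \<in> {f. sign_preserver 2 f}"
  hence f: "sign_preserver 2 f" by simp
  define c where "c = f 1"
  have c: "c \<in> positive_elements"
    using f one_in_positive_elements[where 'a='a]
    unfolding sign_preserver_2_iff c_def by (metis diff_zero mult_1 power_zero_numeral)
  hence c0: "c \<noteq> 0" using zero_notin_positive_elements by auto
  define \<sigma> where "\<sigma> = (\<lambda>x. f x / c)"
  have f_eq: "f = (\<lambda>x. c * \<sigma> x)" using c0 by (simp add: \<sigma>_def)
  have \<sigma>1: "\<sigma> 1 = 1" using c0 by (simp add: \<sigma>_def c_def)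
  have "sign_preserver 2 \<sigma>" using f sign_preserver_2_scale[OF c] unfolding f_eq by blast
  hence pres: "a \<in> positive_elements \<and> a * d - b\<^sup>2 \<in> positive_elements \<longleftrightarrow>
        \<sigma> a \<in> positive_elements \<and> \<sigma> a * \<sigma> d - (\<sigma> b)\<^sup>2 \<in> positive_elements" for a b d
    unfolding sign_preserver_2_iff by blast
  note mult = normalized_sign_preserver_multiplicative[OF odd \<sigma>1 pres]
  have "x - 1 \<in> positive_elements \<longleftrightarrow> \<sigma> x - 1 \<in> positive_elements" for x
    using pres[of 1 x 1] \<sigma>1 one_in_positive_elements[where 'a='a] by simp
  note add = multiplicative_square_difference_preserver_additive[OF odd mult(2,1) this]
  have "surj \<sigma>" using mult(1) by (simp add: finite_UNIV_inj_surj)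
  moreover have "\<sigma> 0 = 0" using add[of 0 0] by (simp only: add_0_right add_cancel_right_right)
  ultimately have "field_isom \<sigma>"
    using add mult(2) \<sigma>1 by unfold_locales auto
  thus "f \<in> positive_multiples_of_automorphisms"
    using c f_eq unfolding positive_multiples_of_automorphisms_def by blast
next
  fix f :: "'a \<Rightarrow> 'a" assume "f \<in> positive_multiples_of_automorphisms"
  then obtain c \<sigma> where f: "f = (\<lambda>x. c * \<sigma> x)" "c \<in> positive_elements" and iso: "field_isom \<sigma>"
    unfolding positive_multiples_of_automorphisms_def by blast
  interpret field_isom \<sigma> by (rule iso)
  have sq: "\<sigma> x \<in> positive_elements \<longleftrightarrow> x \<in> positive_elements" for x
  proof
    assume "x \<in> positive_elements"
    then obtain y where "y \<noteq> 0" "x = y\<^sup>2" by (auto simp: positive_elements_def)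
    thus "\<sigma> x \<in> positive_elements" by (simp add: hom_power power2_in_positive_elements)
  next
    assume "\<sigma> x \<in> positive_elements"
    then obtain y where y: "y \<noteq> 0" "\<sigma> x = y\<^sup>2" by (auto simp: positive_elements_def)
    obtain z where z: "y = \<sigma> z" using surj by (rule surjE)
    have "\<sigma> x = \<sigma> (z\<^sup>2)" using y z by (simp add: hom_power)
    hence "x = z\<^sup>2" by simp
    moreover have "z \<noteq> 0" using y z by auto
    ultimately show "x \<in> positive_elements" by (simp add: power2_in_positive_elements)
  qed
  have "\<sigma> a * \<sigma> d - (\<sigma> b)\<^sup>2 = \<sigma> (a * d - b\<^sup>2)" for a b d by (simp add: hom_distribs)
  hence "sign_preserver 2 \<sigma>" by (simp add: sign_preserver_2_iff sq)
  thus "f \<in> {f. sign_preserver 2 f}" using sign_preserver_2_scale[OF f(2)] f(1) by simp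
qed

theorem theorem4:
  fixes q :: nat
  assumes "CARD('a::{field,finite}) = q"
  shows "(even q \<longrightarrow> {f :: 'a \<Rightarrow> 'a. sign_preserver 2 f} = bijective_monomials) \<and>
         (odd q \<longrightarrow> {f :: 'a \<Rightarrow> 'a. sign_preserver 2 f} = positive_multiples_of_automorphisms)"
  using assms sign_preservers_2_even sign_preservers_2_odd by blast

end
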